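(* Let $p$ be a prime, $q$ a positive integer, and $A\in\{-1,1\}^{q\times q}$. Let $r$ be a positive integer with $r\le q$ and $\delta\in(0,1/2)$, and suppose $\mathcal{R}^{\mathrm{bool},p}_{A}(r)\le\delta q^2$. Suppose further that the fraction of entries of $A$ equal to $1$ and the fraction equal to $-1$ differ by at most $\alpha\in(0,1)$, where $2\alpha+\delta<1/2$. Then for every positive integer $n$, $$\mathcal{R}^{\mathrm{bool},p}_{A^{\otimes n}}(2rn)\;\le\;q^{2n}\left(\frac12-\frac12\left(\frac12-\alpha-\delta\right)^n\right).$$
   Context: $\mathbb{F}_p$ is the field with $p$ elements. For $x\in\mathbb{F}_p$ define $\mathrm{bool}(x)=1$ if $x=1$ in $\mathbb{F}_p$ and $\mathrm{bool}(x)=-1$ otherwise. For $A\in\{-1,1\}^{N\times N}$ and an integer $r\ge0$, the Boolean rigidity $\mathcal{R}^{\mathrm{bool},p}_{A}(r)$ is the minimum, over all $L\in\mathbb{F}_p^{N\times N}$ with $\mathbb{F}_p$-rank at most $r$, of the number of pairs $(i,j)$ with $A[i,j]\neq\mathrm{bool}(L[i,j])$. The Kronecker power $A^{\otimes n}$ is the $q^n\times q^n$ matrix indexed by $\{0,\dots,q-1\}^n$ with $A^{\otimes n}[x,y]=\prod_{i=1}^n A[x_i,y_i]$. *)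

theory Defs
  imports
    Complex_Main
    "Berlekamp_Zassenhaus.Finite_Field"
    "Jordan_Normal_Form.DL_Rank"
begin

text \<open>The field with \<open>p\<close> elements is the type \<open>'p mod_ring\<close>, where \<open>p = CARD('p)\<close> is prime by the
  class constraint \<open>'p :: prime_card\<close>.\<close>

definition bool_sign :: "'p::prime_card mod_ring \<Rightarrow> int" where
  "bool_sign x = (if x = 1 then 1 else - 1)"

text \<open>The argument of type \<open>'p itself\<close> only selects the field over which \<open>L\<close> ranges.
  \<open>vec_space.rank N L\<close> is the dimension of the span of the columns of \<open>L\<close>, where \<open>N\<close> is the
  number of rows.\<close>

definition bool_rigidity :: "'p::prime_card itself \<Rightarrow> int mat \<Rightarrow> nat \<Rightarrow> nat" where
  "bool_rigidity _ A r =
    (let N = dim_row A in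
     Min ((\<lambda>L :: 'p mod_ring mat.
             card {(i, j). i < N \<and> j < N \<and> A $$ (i, j) \<noteq> bool_sign (L $$ (i, j))})
          ` {L \<in> carrier_mat N N. vec_space.rank N L \<le> r}))"

text \<open>Matrix indices are natural numbers, so a tuple \<open>x\<close> in \<open>{0,\<dots>,q-1}\<^sup>n\<close> is represented by the
  number below \<open>q ^ n\<close> whose base-\<open>q\<close> digits are the components of \<open>x\<close>.
  The lemmas \<open>kron_power_index\<close> and \<open>bij_betw_digits\<close> confirm this encoding.\<close>

definition kron_power :: "int mat \<Rightarrow> nat \<Rightarrow> int mat" where
  "kron_power A n =
    (let q = dim_row A in
     mat (q ^ n) (q ^ n)
       (\<lambda>(x, y). \<Prod>k<n. A $$ (x div q ^ k mod q, y div q ^ k mod q)))"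

lemma digits_less:
  fixes q :: nat
  assumes "\<And>k. k < n \<Longrightarrow> f k < q"
  shows "(\<Sum>k<n. f k * q ^ k) < q ^ n"
  using assms
proof (induction n)
  case (Suc n)
  have "Suc (f n) * q ^ n \<le> q * q ^ n"
    using Suc.prems[of n] by (intro mult_right_mono) auto
  then show ?case using Suc by fastforce
qed simp

lemma digits_nth:
  fixes q :: nat
  assumes "\<And>k. k < n \<Longrightarrow> f k < q" "i < n"
  shows "(\<Sum>k<n. f k * q ^ k) div q ^ i mod q = f i"
  using assms
proof (induction n)
  case (Suc n)
  have q: "q > 0" using Suc.prems(1)[of i] Suc.prems(2) by simp
  show ?case
  proof (cases "i = n")
    case True
    then show ?thesis
      using digits_less[of n f q] Suc.prems q by simp
  next
    case False
    then have i: "i < n" using Suc.prems by simp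
    then have "q ^ n = q ^ i * (q * q ^ (n - Suc i))"
      by (metis Suc_leI le_add_diff_inverse mult.assoc power_Suc2 power_add)
    then have "(\<Sum>k<Suc n. f k * q ^ k) =
        (\<Sum>k<n. f k * q ^ k) + q ^ i * (q * (f n * q ^ (n - Suc i)))"
      by (simp add: algebra_simps)
    then have "(\<Sum>k<Suc n. f k * q ^ k) div q ^ i mod q = (\<Sum>k<n. f k * q ^ k) div q ^ i mod q"
      using q by (simp only:) (subst div_mult_self2, simp_all)
    then show ?thesis using Suc i by simp
  qed
qed simp

lemma kron_power_index:
  assumes "A \<in> carrier_mat q q"
    and "\<And>k. k < n \<Longrightarrow> f k < q" "\<And>k. k < n \<Longrightarrow> g k < q"
  shows "kron_power A n $$ (\<Sum>k<n. f k * q ^ k, \<Sum>k<n. g k * q ^ k) = (\<Prod>k<n. A $$ (f k, g k))"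
proof -
  have "dim_row A = q" using assms(1) by simp
  moreover have "(\<Sum>k<n. f k * q ^ k) < q ^ n" "(\<Sum>k<n. g k * q ^ k) < q ^ n"
    using assms(2,3) by (auto intro!: digits_less)
  ultimately have "kron_power A n $$ (\<Sum>k<n. f k * q ^ k, \<Sum>k<n. g k * q ^ k) =
      (\<Prod>i<n. A $$ ((\<Sum>k<n. f k * q ^ k) div q ^ i mod q, (\<Sum>k<n. g k * q ^ k) div q ^ i mod q))"
    by (simp add: kron_power_def Let_def)
  also have "\<dots> = (\<Prod>k<n. A $$ (f k, g k))"
    using assms(2,3) by (intro prod.cong refl) (subst (1 2) digits_nth, simp_all)
  finally show ?thesis .
qed

lemma bij_betw_digits:
  fixes q :: nat
  shows "bij_betw (\<lambda>f. \<Sum>k<n. f k * q ^ k) ({..<n} \<rightarrow>\<^sub>E {..<q}) {..<q ^ n}"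
proof -
  let ?d = "\<lambda>f. \<Sum>k<n. f k * q ^ k" and ?F = "{..<n} \<rightarrow>\<^sub>E {..<q}"
  have inj: "inj_on ?d ?F"
  proof (rule inj_onI)
    fix f g assume fg: "f \<in> ?F" "g \<in> ?F" "?d f = ?d g"
    have "f k = g k" if "k < n" for k
      using digits_nth[of n f q k] digits_nth[of n g q k] fg that by (auto simp: PiE_iff)
    then show "f = g" using fg by (intro PiE_ext) auto
  qed
  moreover have "?d ` ?F \<subseteq> {..<q ^ n}"
    using digits_less by (fastforce simp: PiE_iff)
  moreover have "card (?d ` ?F) = card {..<q ^ n}"
    using card_image[OF inj] by (simp add: card_PiE)
  ultimately show ?thesis
    unfolding bij_betw_def by (meson card_subset_eq finite_lessThan)
qed

lemma bool_rigidity_attained: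
  assumes "A \<in> carrier_mat N N"
  obtains L :: "'p::prime_card mod_ring mat" where
    "L \<in> carrier_mat N N" "vec_space.rank N L \<le> r"
    "bool_rigidity TYPE('p) A r =
       card {(i, j). i < N \<and> j < N \<and> A $$ (i, j) \<noteq> bool_sign (L $$ (i, j))}"
proof -
  let ?e = "\<lambda>L :: 'p mod_ring mat. {(i, j). i < N \<and> j < N \<and> A $$ (i, j) \<noteq> bool_sign (L $$ (i, j))}"
  let ?S = "{L :: 'p mod_ring mat. L \<in> carrier_mat N N \<and> vec_space.rank N L \<le> r}"
  have "?e L \<subseteq> {..<N} \<times> {..<N}" for L
    by (simp add: subset_iff)
  then have "card (?e L) \<in> {..card ({..<N} \<times> {..<N})}" for L
    unfolding atMost_iff by (intro card_mono finite_cartesian_product finite_lessThan)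
  then have fin: "finite ((\<lambda>L. card (?e L)) ` ?S)"
    by (intro finite_subset[OF image_subsetI finite_atMost])
  have "vec_space.rank N (0\<^sub>m N N :: 'p mod_ring mat) = 0"
    by (rule vec_space.rank_0I)
  then have "0\<^sub>m N N \<in> ?S" by simp
  then have "(\<lambda>L. card (?e L)) ` ?S \<noteq> {}" by blast
  from Min_in[OF fin this] obtain L where L: "L \<in> ?S"
    "Min ((\<lambda>L. card (?e L)) ` ?S) = card (?e L)" by blast
  have "dim_row A = N" using assms by simp
  then have "bool_rigidity TYPE('p) A r = card (?e L)"
    unfolding bool_rigidity_def Let_def using L(2) by simp
  then show ?thesis using that L(1) by blast
qed

end

theory Submission
  imports Defs
begin

text \<open>Let \<open>L\<close> attain the rigidity of \<open>A\<close>, and for \<open>s \<in> F\<^sub>p\<^sup>n\<close> put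
  \<open>M\<^sub>s[x, y] = 1 + (\<Sum>k. s\<^sub>k (L[x\<^sub>k, y\<^sub>k] - 1))\<close>. Merging all the constant terms into a single
  matrix of rank one shows that \<open>M\<^sub>s\<close> has rank at most \<open>r n + 1 \<le> 2 r n\<close>. For uniformly random
  \<open>s\<close>, the entry \<open>M\<^sub>s[x, y]\<close> is always 1 if all \<open>L[x\<^sub>k, y\<^sub>k]\<close> are 1, and is uniform on
  \<open>F\<^sub>p\<close> otherwise. Hence the expected correlation of \<open>bool(M\<^sub>s)\<close> with the Kronecker power is
  \<open>(2/p - 1) (E A)\<^sup>n + (2 - 2/p) (E [L = 1] A)\<^sup>n\<close>, with expectations over a uniform entry. Now
  \<open>\<bar>E A\<bar> \<le> \<alpha> < 1/2 - \<alpha> - \<delta> \<le> E [L = 1] A\<close>, so the correlation is at least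
  \<open>(1/2 - \<alpha> - \<delta>)\<^sup>n\<close>, and some \<open>s\<close> does as well as the average.\<close>

section \<open>Rank and sums of outer products\<close>

text \<open>Each summand is an outer product, hence of rank at most one, and rank is
  subadditive.\<close>

lemma (in vec_space) rank_le_card_of_sum_products:
  fixes u v :: "'t \<Rightarrow> nat \<Rightarrow> 'a"
  assumes "finite T"
  shows "rank (mat n nc (\<lambda>(i, j). \<Sum>t\<in>T. u t i * v t j)) \<le> card T"
  using assms
proof (induction T)
  case empty
  have "mat n nc (\<lambda>(i, j). \<Sum>t\<in>{}. u t i * v t j) = 0\<^sub>m n nc"
    by (intro eq_matI) auto
  then show ?case using rank_0I by (simp only: card.empty)
next
  case (insert t T)
  let ?B = "mat n nc (\<lambda>(i, j). u t i * v t j)"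
  let ?C = "mat n nc (\<lambda>(i, j). \<Sum>t\<in>T. u t i * v t j)"
  have "mat n nc (\<lambda>(i, j). \<Sum>t\<in>insert t T. u t i * v t j) = ?B + ?C"
    using insert.hyps by (intro eq_matI) auto
  moreover have "rank (?B + ?C) \<le> rank ?B + rank ?C"
    by (intro rank_subadditive) auto
  moreover have "rank ?B \<le> 1"
    by (rule rank_le_1_product_entries[where f = "u t" and g = "v t"]) auto
  ultimately show ?case using insert by simp
qed

text \<open>A maximal independent set \<open>S\<close> of columns spans all columns;
  \<open>c b j\<close> is the coefficient of \<open>b\<close> in column \<open>j\<close>.\<close>

lemma (in vec_space) rank_factorization:
  assumes "A \<in> carrier_mat n nc"
  obtains S :: "'a vec set" and c where
    "finite S" "card S = rank A"
    "\<And>i j. i < n \<Longrightarrow> j < nc \<Longrightarrow> A $$ (i, j) = (\<Sum>b\<in>S. b $ i * c b j)"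
proof -
  let ?P = "\<lambda>T. T \<subseteq> set (cols A) \<and> lin_indpt T"
  have carrier: "set (cols A) \<subseteq> carrier_vec n"
    using cols_dim assms by blast
  have "?P {}"
    by (metis empty_subsetI fin_dim finite_basis_exists subset_li_is_li vec_vs vectorspace.basis_def)
  then obtain S where S: "finite S" "maximal S ?P"
    using maximal_exists_superset[of "set (cols A)" ?P "{}"] by blast
  then have sub: "S \<subseteq> set (cols A)" and indpt: "lin_indpt S"
    unfolding maximal_def by auto
  have SV: "S \<subseteq> carrier_vec n" using sub carrier by blast
  have "\<exists>a. col A j = lincomb a S" if j: "j < nc" for j
  proof -
    have col: "col A j \<in> set (cols A)"
      using j assms by (auto simp: cols_def)
    have "col A j \<in> span S"
    proof (rule ccontr)
      \<comment> \<open>A column outside the span would extend \<open>S\<close> to a larger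
        independent set, against maximality.\<close>
      assume not_in: "col A j \<notin> span S"
      then have notS: "col A j \<notin> S" using in_own_span[OF SV] by blast
      have "lin_indpt (S \<union> {col A j})"
        using not_in lin_dep_iff_in_span[OF SV indpt _ notS] col carrier by blast
      then have "S \<union> {col A j} = S"
        using S(2) sub col unfolding maximal_def by blast
      then show False using notS by blast
    qed
    then obtain a where "lincomb a S = col A j"
      using finite_in_span[OF S(1)] SV by (metis module_vec_simps(3))
    then show ?thesis by metis
  qed
  then obtain a where a: "\<And>j. j < nc \<Longrightarrow> col A j = lincomb (a j) S" by metis
  show ?thesis
  proof (rule that[of S "\<lambda>b j. a j b"])
    show "card S = rank A" using rank_card_indpt[OF assms S(2)] by simp
    fix i j assume ij: "i < n" "j < nc"
    have "A $$ (i, j) = lincomb (a j) S $ i"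
      using a[OF ij(2)] ij assms by (metis carrier_matD index_col)
    also have "\<dots> = (\<Sum>b\<in>S. b $ i * a j b)"
      using lincomb_index[OF ij(1) SV] by (simp add: mult.commute)
    finally show "A $$ (i, j) = (\<Sum>b\<in>S. b $ i * a j b)" .
  qed (rule S(1))
qed

section \<open>Sums over digits and over coefficient vectors\<close>

text \<open>This is distributivity, with the choice functions of the expanded product encoded as
  base-\<open>q\<close> numbers.\<close>

lemma sum_prod_digits:
  fixes h :: "nat \<Rightarrow> nat \<Rightarrow> 'a::comm_semiring_1"
  shows "(\<Sum>x<q ^ n. \<Prod>k<n. h k (x div q ^ k mod q)) = (\<Prod>k<n. \<Sum>i<q. h k i)"
proof -
  have "(\<Prod>k<n. \<Sum>i<q. h k i) = (\<Sum>f\<in>{..<n} \<rightarrow>\<^sub>E {..<q}. \<Prod>k<n. h k (f k))"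
    by (rule prod_sum_PiE) auto
  also have "\<dots> = (\<Sum>f\<in>{..<n} \<rightarrow>\<^sub>E {..<q}.
      \<Prod>k<n. h k ((\<Sum>l<n. f l * q ^ l) div q ^ k mod q))"
    by (intro sum.cong prod.cong refl) (subst digits_nth, auto simp: PiE_iff)
  also have "\<dots> = (\<Sum>x<q ^ n. \<Prod>k<n. h k (x div q ^ k mod q))"
    by (rule sum.reindex_bij_betw[OF bij_betw_digits])
  finally show ?thesis by simp
qed

text \<open>For fixed \<open>x\<close> the sum over \<open>y\<close> factors into row sums, each
  depending on one digit of \<open>x\<close>; the sum over \<open>x\<close> then factors in the same
  way.\<close>

lemma sum_prod_digit_pairs:
  fixes f :: "nat \<Rightarrow> nat \<Rightarrow> 'a::comm_semiring_1"
  shows "(\<Sum>x<q ^ n. \<Sum>y<q ^ n. \<Prod>k<n. f (x div q ^ k mod q) (y div q ^ k mod q)) =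
    (\<Sum>i<q. \<Sum>j<q. f i j) ^ n"
proof -
  have "(\<Sum>y<q ^ n. \<Prod>k<n. f (x div q ^ k mod q) (y div q ^ k mod q)) =
      (\<Prod>k<n. \<Sum>j<q. f (x div q ^ k mod q) j)" for x
    by (rule sum_prod_digits)
  then show ?thesis
    using sum_prod_digits[of "\<lambda>k i. \<Sum>j<q. f i j" q n] by simp
qed

text \<open>A nonzero linear form takes every value equally often: translating along a coordinate with
  nonzero coefficient averages it over the whole field.\<close>

lemma sum_over_nonzero_linear_form:
  fixes z :: "'i \<Rightarrow> 'a::{field, finite}" and g :: "'a \<Rightarrow> 'b::comm_semiring_1"
  assumes "finite K" "m \<in> K" "z m \<noteq> 0"
  shows "of_nat CARD('a) * (\<Sum>s\<in>K \<rightarrow>\<^sub>E UNIV. g (\<Sum>k\<in>K. s k * z k)) =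
    of_nat (CARD('a) ^ card K) * (\<Sum>c\<in>UNIV. g c)"
proof -
  let ?E = "K \<rightarrow>\<^sub>E (UNIV :: 'a set)" and ?l = "\<lambda>s. \<Sum>k\<in>K. s k * z k"
  have translate: "(\<Sum>s\<in>?E. g (?l s)) = (\<Sum>s\<in>?E. g (?l s + t * z m))" for t
  proof (rule sum.reindex_bij_witness[where
        i = "\<lambda>s. s(m := s m + t)" and j = "\<lambda>s. s(m := s m - t)"])
    fix s assume "s \<in> ?E"
    have "?l (s(m := s m - t)) + t * z m = ?l s"
      using assms by (simp add: sum.remove[of K m] algebra_simps cong: sum.cong_simp)
    then show "g (?l (s(m := s m - t)) + t * z m) = g (?l s)" by simp
  qed (use assms(2) in \<open>auto simp: PiE_iff extensional_def\<close>)
  have shift: "(\<Sum>t\<in>UNIV. g (a + t * z m)) = (\<Sum>c\<in>UNIV. g c)" for a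
    by (rule sum.reindex_bij_witness[where i = "\<lambda>c. (c - a) / z m" and j = "\<lambda>t. a + t * z m"])
      (use assms(3) in auto)
  \<comment> \<open>The factor \<open>CARD('a)\<close> becomes a sum over a dummy shift
    \<open>t\<close>, which \<open>translate\<close> then moves into the argument of
    \<open>g\<close>.\<close>
  have "of_nat CARD('a) * (\<Sum>s\<in>?E. g (?l s)) = (\<Sum>t\<in>(UNIV :: 'a set). \<Sum>s\<in>?E. g (?l s))"
    by simp
  also have "\<dots> = (\<Sum>t\<in>UNIV. \<Sum>s\<in>?E. g (?l s + t * z m))"
    using translate by (rule sum.cong[OF refl])
  also have "\<dots> = (\<Sum>s\<in>?E. \<Sum>t\<in>UNIV. g (?l s + t * z m))"
    by (rule sum.swap)
  also have "\<dots> = of_nat (CARD('a) ^ card K) * (\<Sum>c\<in>UNIV. g c)"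
    using assms(1) by (simp add: shift card_PiE)
  finally show ?thesis .
qed

text \<open>Over the whole field, \<open>bool_sign (1 + c)\<close> takes the value 1 once, at
  \<open>c = 0\<close>, and -1 otherwise, which adds up to 2 - p. This settles the case of a nonzero
  form, which is equidistributed. For the zero form every summand is 1, matching (2 - p) + (2p - 2)
  = p.\<close>

lemma sum_bool_sign_linear_form:
  fixes z :: "nat \<Rightarrow> 'p::prime_card mod_ring"
  shows "real CARD('p) * (\<Sum>s\<in>{..<n} \<rightarrow>\<^sub>E UNIV. real_of_int (bool_sign (1 + (\<Sum>k<n. s k * z k)))) =
    real (CARD('p) ^ n) *
      ((2 - real CARD('p)) + (2 * real CARD('p) - 2) * (\<Prod>k<n. of_bool (z k = 0)))"
proof (cases "\<exists>m<n. z m \<noteq> 0")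
  case True
  then obtain m where m: "m < n" "z m \<noteq> 0" by blast
  have "(\<Sum>c\<in>UNIV. real_of_int (bool_sign (1 + c :: 'p mod_ring))) =
      (\<Sum>c\<in>(UNIV :: 'p mod_ring set). (if c = 0 then 2 else 0) - 1)"
    by (intro sum.cong) (auto simp: bool_sign_def)
  also have "\<dots> = 2 - real CARD('p)" by (simp add: sum_subtractf)
  finally have *: "(\<Sum>c\<in>UNIV. real_of_int (bool_sign (1 + c :: 'p mod_ring))) = 2 - real CARD('p)" .
  have **: "(\<Prod>k<n. of_bool (z k = 0)) = (0 :: real)"
    using m by (intro prod_zero) auto
  show ?thesis
    using sum_over_nonzero_linear_form[of "{..<n}" m z "\<lambda>c. real_of_int (bool_sign (1 + c))"] m * **
    by simp
next
  case False
  then have "\<And>k. k < n \<Longrightarrow> z k = 0" by blast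
  then show ?thesis
    by (simp add: bool_sign_def card_PiE cong: prod.cong_simp sum.cong_simp)
qed

section \<open>Rigidity, sign errors and Kronecker powers\<close>

lemma bool_rigidity_le:
  fixes L :: "'p::prime_card mod_ring mat"
  assumes "A \<in> carrier_mat N N" "L \<in> carrier_mat N N" "vec_space.rank N L \<le> r"
  shows "bool_rigidity TYPE('p) A r \<le>
    card {(i, j). i < N \<and> j < N \<and> A $$ (i, j) \<noteq> bool_sign (L $$ (i, j))}"
proof -
  let ?e = "\<lambda>L :: 'p mod_ring mat. {(i, j). i < N \<and> j < N \<and> A $$ (i, j) \<noteq> bool_sign (L $$ (i, j))}"
  let ?S = "{L :: 'p mod_ring mat. L \<in> carrier_mat N N \<and> vec_space.rank N L \<le> r}"
  have "?e L \<subseteq> {..<N} \<times> {..<N}" for L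
    by (simp add: subset_iff)
  then have "card (?e L) \<in> {..card ({..<N} \<times> {..<N})}" for L
    unfolding atMost_iff by (intro card_mono finite_cartesian_product finite_lessThan)
  then have "finite ((\<lambda>L. card (?e L)) ` ?S)"
    by (intro finite_subset[OF image_subsetI finite_atMost])
  moreover have "dim_row A = N" using assms(1) by simp
  ultimately show ?thesis
    unfolding bool_rigidity_def Let_def using assms(2,3) by (intro Min_le) auto
qed

lemma card_pairs_eq_sum:
  fixes N :: nat
  shows "real (card {(i, j). i < N \<and> j < N \<and> P i j}) = (\<Sum>i<N. \<Sum>j<N. of_bool (P i j))"
proof -
  have "{(i, j). i < N \<and> j < N \<and> P i j} = ({..<N} \<times> {..<N}) \<inter> {x. P (fst x) (snd x)}"
    by auto
  then have "real (card {(i, j). i < N \<and> j < N \<and> P i j}) =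
      (\<Sum>x\<in>{..<N} \<times> {..<N}. of_bool (P (fst x) (snd x)))"
    by simp
  also have "\<dots> = (\<Sum>i<N. \<Sum>j<N. of_bool (P i j))"
    by (simp only: sum.cartesian_product case_prod_unfold)
  finally show ?thesis .
qed

text \<open>The product of two signs is 1 if they agree and -1 if not, so half of 1 minus the
  product is the indicator of an error.\<close>

lemma card_sign_errors:
  assumes "\<And>i j. i < N \<Longrightarrow> j < N \<Longrightarrow> A $$ (i, j) \<in> {- 1, 1 :: int}"
  shows "real (card {(i, j). i < N \<and> j < N \<and> A $$ (i, j) \<noteq> bool_sign (L $$ (i, j))}) =
    (real N ^ 2 - (\<Sum>i<N. \<Sum>j<N. real_of_int (bool_sign (L $$ (i, j)) * A $$ (i, j)))) / 2"
proof -
  have "(\<Sum>i<N. \<Sum>j<N. of_bool (A $$ (i, j) \<noteq> bool_sign (L $$ (i, j)))) =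
      (\<Sum>i<N. \<Sum>j<N. (1 - real_of_int (bool_sign (L $$ (i, j)) * A $$ (i, j))) / 2)"
    using assms by (intro sum.cong refl) (force simp: bool_sign_def)
  then show ?thesis
    unfolding card_pairs_eq_sum
    by (simp add: sum_subtractf power2_eq_square flip: sum_divide_distrib)
qed

lemma kron_power_carrier:
  "A \<in> carrier_mat q q \<Longrightarrow> kron_power A n \<in> carrier_mat (q ^ n) (q ^ n)"
  by (simp add: kron_power_def Let_def)

lemma kron_power_entry:
  assumes "A \<in> carrier_mat q q" "x < q ^ n" "y < q ^ n"
  shows "kron_power A n $$ (x, y) = (\<Prod>k<n. A $$ (x div q ^ k mod q, y div q ^ k mod q))"
  using assms by (simp add: kron_power_def Let_def)

lemma kron_power_sign:
  assumes "q > 0" "A \<in> carrier_mat q q" "x < q ^ n" "y < q ^ n"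
    and "\<And>i j. i < q \<Longrightarrow> j < q \<Longrightarrow> A $$ (i, j) \<in> {- 1, 1}"
  shows "kron_power A n $$ (x, y) \<in> {- 1, 1}"
proof -
  have "\<bar>A $$ (x div q ^ k mod q, y div q ^ k mod q)\<bar> = 1" for k
    using assms(5)[of "x div q ^ k mod q" "y div q ^ k mod q"] assms(1) by auto
  then have "\<bar>kron_power A n $$ (x, y)\<bar> = 1"
    by (simp add: kron_power_entry[OF assms(2-4)] abs_prod)
  then show ?thesis by auto
qed

section \<open>The random matrices: rank and expected correlation\<close>

definition digit_form ::
  "nat \<Rightarrow> nat \<Rightarrow> 'a::comm_ring_1 mat \<Rightarrow> (nat \<Rightarrow> 'a) \<Rightarrow> 'a mat" where
  "digit_form q n L s = mat (q ^ n) (q ^ n)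
    (\<lambda>(x, y). 1 + (\<Sum>k<n. s k * (L $$ (x div q ^ k mod q, y div q ^ k mod q) - 1)))"

text \<open>Factoring \<open>L\<close> expands each of the \<open>n\<close> digit terms into as many
  outer products as the rank of \<open>L\<close>. The constants left over merge into a single
  further one.\<close>

lemma rank_digit_form:
  fixes L :: "'a::field mat"
  assumes "q > 0" "L \<in> carrier_mat q q"
  shows "vec_space.rank (q ^ n) (digit_form q n L s) \<le> n * vec_space.rank q L + 1"
proof -
  obtain S :: "'a vec set" and c where S: "finite S" "card S = vec_space.rank q L"
    and L: "\<And>i j. i < q \<Longrightarrow> j < q \<Longrightarrow> L $$ (i, j) = (\<Sum>b\<in>S. b $ i * c b j)"
    using vec_space.rank_factorization[OF assms(2)] by blast
  let ?T = "{..<n} \<times> S"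
  \<comment> \<open>\<open>None\<close> indexes the constant term, \<open>Some (k, b)\<close> the
    outer product that \<open>b\<close> contributes at digit \<open>k\<close>.\<close>
  define u where "u t x = (case t of None \<Rightarrow> 1 - (\<Sum>k<n. s k)
    | Some (k, b) \<Rightarrow> s k * b $ (x div q ^ k mod q))" for t and x :: nat
  define v where "v t y = (case t of None \<Rightarrow> 1
    | Some (k, b) \<Rightarrow> c b (y div q ^ k mod q))" for t and y :: nat
  have "digit_form q n L s =
      mat (q ^ n) (q ^ n) (\<lambda>(x, y). \<Sum>t\<in>insert None (Some ` ?T). u t x * v t y)"
  proof -
    have "(\<Sum>t\<in>insert None (Some ` ?T). u t x * v t y) =
        1 + (\<Sum>k<n. s k * (L $$ (x div q ^ k mod q, y div q ^ k mod q) - 1))" for x y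
    proof -
      have "(\<Sum>t\<in>insert None (Some ` ?T). u t x * v t y) =
          1 - (\<Sum>k<n. s k) + (\<Sum>k<n. \<Sum>b\<in>S. s k * b $ (x div q ^ k mod q) * c b (y div q ^ k mod q))"
        using S(1) by (simp add: u_def v_def sum.reindex sum.cartesian_product case_prod_beta)
      also have "\<dots> = 1 - (\<Sum>k<n. s k) + (\<Sum>k<n. s k * L $$ (x div q ^ k mod q, y div q ^ k mod q))"
        using assms(1) by (simp add: L sum_distrib_left mult.assoc)
      finally show ?thesis by (simp add: right_diff_distrib sum_subtractf)
    qed
    then show ?thesis by (simp add: digit_form_def)
  qed
  then have "vec_space.rank (q ^ n) (digit_form q n L s) \<le> card (insert None (Some ` ?T))"
    using S(1) by (simp only:) (rule vec_space.rank_le_card_of_sum_products, simp)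
  also have "\<dots> = n * vec_space.rank q L + 1"
    using S by (simp add: card_image card_cartesian_product)
  finally show ?thesis .
qed

text \<open>With the sum over \<open>s\<close> innermost, \<open>sum_bool_sign_linear_form\<close>
  evaluates it entry by entry. Both resulting terms are products over digits, so summing over
  \<open>x\<close> and \<open>y\<close> gives \<open>n\<close>-th powers.\<close>

lemma sum_correlation_digit_form:
  fixes L :: "'p::prime_card mod_ring mat"
  assumes "A \<in> carrier_mat q q"
  shows "real CARD('p) * (\<Sum>s\<in>{..<n} \<rightarrow>\<^sub>E UNIV. \<Sum>x<q ^ n. \<Sum>y<q ^ n.
      real_of_int (bool_sign (digit_form q n L s $$ (x, y)) * kron_power A n $$ (x, y))) =
    real (CARD('p) ^ n) * ((2 - real CARD('p)) * (\<Sum>i<q. \<Sum>j<q. real_of_int (A $$ (i, j))) ^ n +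
      (2 * real CARD('p) - 2) *
        (\<Sum>i<q. \<Sum>j<q. of_bool (L $$ (i, j) = 1) * real_of_int (A $$ (i, j))) ^ n)"
  (is "?p * _ = _")
proof -
  let ?E = "{..<n} \<rightarrow>\<^sub>E (UNIV :: 'p mod_ring set)"
  let ?d = "\<lambda>x k. x div q ^ k mod q"
  let ?z = "\<lambda>x y k. L $$ (?d x k, ?d y k) - 1"
  let ?a = "\<lambda>x y k. real_of_int (A $$ (?d x k, ?d y k))"
  have "?p * (\<Sum>s\<in>?E. \<Sum>x<q ^ n. \<Sum>y<q ^ n.
      real_of_int (bool_sign (digit_form q n L s $$ (x, y)) * kron_power A n $$ (x, y))) =
    ?p * (\<Sum>s\<in>?E. \<Sum>x<q ^ n. \<Sum>y<q ^ n.
      real_of_int (bool_sign (1 + (\<Sum>k<n. s k * ?z x y k))) * (\<Prod>k<n. ?a x y k))"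
    by (simp add: digit_form_def kron_power_entry[OF assms])
  also have "\<dots> = ?p * (\<Sum>x<q ^ n. \<Sum>y<q ^ n. \<Sum>s\<in>?E.
      real_of_int (bool_sign (1 + (\<Sum>k<n. s k * ?z x y k))) * (\<Prod>k<n. ?a x y k))"
    by (subst sum.swap, subst (2) sum.swap) (rule refl)
  also have "\<dots> = (\<Sum>x<q ^ n. \<Sum>y<q ^ n.
      ?p * (\<Sum>s\<in>?E. real_of_int (bool_sign (1 + (\<Sum>k<n. s k * ?z x y k)))) * (\<Prod>k<n. ?a x y k))"
    by (simp add: sum_distrib_left sum_distrib_right mult.assoc)
  \<comment> \<open>The indicators of \<open>L = 1\<close> are absorbed into the product of entries
    of \<open>A\<close>, keeping it a product over digits.\<close>
  also have "\<dots> = (\<Sum>x<q ^ n. \<Sum>y<q ^ n. ?p ^ n * ((2 - ?p) * (\<Prod>k<n. ?a x y k) +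
      (2 * ?p - 2) * (\<Prod>k<n. of_bool (L $$ (?d x k, ?d y k) = 1) * ?a x y k)))"
    unfolding sum_bool_sign_linear_form by (simp add: prod.distrib algebra_simps)
  also have "\<dots> = ?p ^ n * ((2 - ?p) * (\<Sum>x<q ^ n. \<Sum>y<q ^ n. \<Prod>k<n. ?a x y k) +
      (2 * ?p - 2) * (\<Sum>x<q ^ n. \<Sum>y<q ^ n. \<Prod>k<n. of_bool (L $$ (?d x k, ?d y k) = 1) * ?a x y k))"
    by (simp only: sum_distrib_left sum.distrib distrib_left mult.assoc)
  also have "\<dots> = ?p ^ n * ((2 - ?p) * (\<Sum>i<q. \<Sum>j<q. real_of_int (A $$ (i, j))) ^ n +
      (2 * ?p - 2) * (\<Sum>i<q. \<Sum>j<q. of_bool (L $$ (i, j) = 1) * real_of_int (A $$ (i, j))) ^ n)"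
    unfolding sum_prod_digit_pairs[of "\<lambda>i j. real_of_int (A $$ (i, j))"]
      sum_prod_digit_pairs[of "\<lambda>i j. of_bool (L $$ (i, j) = 1) * real_of_int (A $$ (i, j))"] ..
  finally show ?thesis by simp
qed

section \<open>Choosing a coefficient vector at least as good as the average\<close>

theorem theorem1p5:
  fixes A :: "int mat" and q r n :: nat and \<delta> \<alpha> :: real
  assumes "q > 0"
    and "A \<in> carrier_mat q q"
    and "\<And>i j. i < q \<Longrightarrow> j < q \<Longrightarrow> A $$ (i, j) \<in> {- 1, 1}"
    and "r > 0" and "r \<le> q"
    and "0 < \<delta>" and "\<delta> < 1 / 2"
    and "real (bool_rigidity TYPE('p::prime_card) A r) \<le> \<delta> * real q ^ 2"
    and "0 < \<alpha>" and "\<alpha> < 1"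
    and "\<bar>real (card {(i, j). i < q \<and> j < q \<and> A $$ (i, j) = 1}) / real q ^ 2
          - real (card {(i, j). i < q \<and> j < q \<and> A $$ (i, j) = - 1}) / real q ^ 2\<bar> \<le> \<alpha>"
    and "2 * \<alpha> + \<delta> < 1 / 2"
    and "n > 0"
  shows "real (bool_rigidity TYPE('p) (kron_power A n) (2 * r * n))
    \<le> real q ^ (2 * n) * (1 / 2 - 1 / 2 * (1 / 2 - \<alpha> - \<delta>) ^ n)"
proof -
  obtain L :: "'p mod_ring mat" where L: "L \<in> carrier_mat q q" "vec_space.rank q L \<le> r"
    "bool_rigidity TYPE('p) A r =
       card {(i, j). i < q \<and> j < q \<and> A $$ (i, j) \<noteq> bool_sign (L $$ (i, j))}"
    using bool_rigidity_attained[OF assms(2)] .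
  let ?p = "real CARD('p)"
  define pos where "pos = real (card {(i, j). i < q \<and> j < q \<and> A $$ (i, j) = 1})"
  define neg where "neg = real (card {(i, j). i < q \<and> j < q \<and> A $$ (i, j) = - 1})"
  define err where "err = real (bool_rigidity TYPE('p) A r)"
  define S0 where "S0 = (\<Sum>i<q. \<Sum>j<q. real_of_int (A $$ (i, j)))"
  define S1 where "S1 = (\<Sum>i<q. \<Sum>j<q. of_bool (L $$ (i, j) = 1) * real_of_int (A $$ (i, j)))"
  \<comment> \<open>\<open>\<beta>\<close> will separate the two sums:
    \<open>\<bar>S0\<bar> \<le> \<beta> \<le> S1\<close>.\<close>
  define \<beta> where "\<beta> = real q ^ 2 * (1 / 2 - \<alpha> - \<delta>)"
  have q2: "real q ^ 2 > 0" using assms(1) by simp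
  have "pos + neg = (\<Sum>i<q. \<Sum>j<q. 1)"
    unfolding pos_def neg_def card_pairs_eq_sum sum.distrib[symmetric]
    using assms(3) by (intro sum.cong refl) force
  then have total: "pos + neg = real q ^ 2" by (simp add: power2_eq_square)
  have S0: "S0 = pos - neg"
    unfolding S0_def pos_def neg_def card_pairs_eq_sum sum_subtractf[symmetric]
    using assms(3) by (intro sum.cong refl) force
  \<comment> \<open>Entrywise: where \<open>L\<close> is 1, errors are the entries -1 of
    \<open>A\<close>; elsewhere they are the entries 1, and cancel against
    \<open>pos\<close>.\<close>
  have S1: "S1 = pos - err"
    unfolding S1_def pos_def err_def L(3) card_pairs_eq_sum sum_subtractf[symmetric]
    using assms(3) by (intro sum.cong refl) (force simp: bool_sign_def)
  have "\<bar>S0 / real q ^ 2\<bar> \<le> \<alpha>"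
    using assms(11) by (simp add: S0 pos_def neg_def diff_divide_distrib)
  then have absS0: "\<bar>S0\<bar> \<le> \<alpha> * real q ^ 2"
    using q2 by (simp add: field_simps)
  have "\<alpha> * real q ^ 2 \<le> (1 / 2 - \<alpha> - \<delta>) * real q ^ 2"
    using assms(12) by (intro mult_right_mono) auto
  then have S0_le: "\<bar>S0\<bar> \<le> \<beta>" using absS0 by (simp add: \<beta>_def mult.commute)
  have "\<beta> \<le> S1"
  proof -
    \<comment> \<open>Near balance makes \<open>pos\<close> at least (1 - \<alpha>)/2 of all
      entries; subtracting the errors leaves 1/2 - \<alpha>/2 - \<delta>, which is at least 1/2 -
      \<alpha> - \<delta>.\<close>
    have "2 * pos \<ge> real q ^ 2 - \<alpha> * real q ^ 2"
      using absS0 S0 total by linarith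
    moreover have "0 \<le> \<alpha> * real q ^ 2" using assms(9) by simp
    moreover have "err \<le> \<delta> * real q ^ 2" using assms(8) by (simp add: err_def)
    ultimately show ?thesis unfolding S1 \<beta>_def by (simp add: algebra_simps)
  qed
  then have "\<beta> ^ n \<le> S1 ^ n" using S0_le by (intro power_mono) auto
  moreover have "S0 ^ n \<le> \<beta> ^ n"
    using S0_le by (metis abs_ge_self abs_ge_zero order_trans power_abs power_mono)
  moreover have "?p \<ge> 2"
    using prime_ge_2_nat[OF prime_card[where 'a = 'p]] by simp
  \<comment> \<open>Since p \<ge> 2, the coefficient 2 - p of \<open>S0 ^ n\<close> is not positive,
    so an upper bound on \<open>S0 ^ n\<close> is what is needed. The two weights differ by exactly
    p.\<close>
  ultimately have "(2 * ?p - 2) * \<beta> ^ n - (?p - 2) * \<beta> ^ n \<le>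
      (2 * ?p - 2) * S1 ^ n - (?p - 2) * S0 ^ n"
    by (intro diff_mono mult_left_mono) auto
  then have corr: "?p * \<beta> ^ n \<le> (2 - ?p) * S0 ^ n + (2 * ?p - 2) * S1 ^ n"
    by (simp add: algebra_simps)
  define C where "C s = (\<Sum>x<q ^ n. \<Sum>y<q ^ n. real_of_int
    (bool_sign (digit_form q n L s $$ (x, y)) * kron_power A n $$ (x, y)))" for s
  let ?E = "{..<n} \<rightarrow>\<^sub>E (UNIV :: 'p mod_ring set)"
  have "?p * (\<Sum>s\<in>?E. \<beta> ^ n) = real (CARD('p) ^ n) * (?p * \<beta> ^ n)"
    by (simp add: card_PiE)
  also have "\<dots> \<le> real (CARD('p) ^ n) * ((2 - ?p) * S0 ^ n + (2 * ?p - 2) * S1 ^ n)"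
    by (intro mult_left_mono corr) auto
  also have "\<dots> = ?p * (\<Sum>s\<in>?E. C s)"
    unfolding C_def S0_def S1_def by (rule sum_correlation_digit_form[OF assms(2), symmetric])
  finally have avg: "(\<Sum>s\<in>?E. \<beta> ^ n) \<le> (\<Sum>s\<in>?E. C s)" by simp
  have "\<exists>s\<in>?E. \<beta> ^ n \<le> C s"
  proof (rule ccontr)
    assume "\<not> (\<exists>s\<in>?E. \<beta> ^ n \<le> C s)"
    then have "(\<Sum>s\<in>?E. C s) < (\<Sum>s\<in>?E. \<beta> ^ n)"
      by (intro sum_strict_mono) (auto simp: finite_PiE PiE_eq_empty_iff not_le)
    then show False using avg by simp
  qed
  then obtain s where s: "\<beta> ^ n \<le> C s" by blast
  let ?M = "digit_form q n L s"
  \<comment> \<open>The extra 1 is absorbed by a second \<open>n * r\<close>, as \<open>n\<close>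
    and \<open>r\<close> are positive.\<close>
  have "n * vec_space.rank q L + 1 \<le> n * r + n * r"
    using L(2) assms(4,13) by (intro add_mono mult_left_mono) auto
  then have "vec_space.rank (q ^ n) ?M \<le> 2 * r * n"
    using rank_digit_form[OF assms(1) L(1), of n s] by (simp add: mult.commute)
  moreover have "?M \<in> carrier_mat (q ^ n) (q ^ n)" by (simp add: digit_form_def)
  ultimately have "real (bool_rigidity TYPE('p) (kron_power A n) (2 * r * n)) \<le>
      real (card {(i, j). i < q ^ n \<and> j < q ^ n \<and> kron_power A n $$ (i, j) \<noteq> bool_sign (?M $$ (i, j))})"
    using bool_rigidity_le[OF kron_power_carrier[OF assms(2)]] by simp
  also have "\<dots> = (real (q ^ n) ^ 2 - C s) / 2"
    unfolding C_def using kron_power_sign[OF assms(1,2) _ _ assms(3)] by (intro card_sign_errors) auto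
  also have "\<dots> \<le> (real (q ^ n) ^ 2 - \<beta> ^ n) / 2" using s by simp
  also have "\<dots> = real q ^ (2 * n) * (1 / 2 - 1 / 2 * (1 / 2 - \<alpha> - \<delta>) ^ n)"
  proof -
    have "\<beta> ^ n = real q ^ (2 * n) * (1 / 2 - \<alpha> - \<delta>) ^ n"
      by (simp only: \<beta>_def power_mult_distrib power_mult)
    moreover have "real (q ^ n) ^ 2 = real q ^ (2 * n)"
      by (simp add: power_even_eq)
    ultimately show ?thesis by (simp only:) (simp add: field_simps)
  qed
  finally show ?thesis .
qed

end
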